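(* Let $\mathcal{X}$ and $\mathcal{O}$ be finite non-empty sets, let $\Gamma$ be a multi-valued map assigning to each $x\in\mathcal{X}$ a non-empty subset $\Gamma(x)\subseteq\mathcal{O}$, and let $\underline{P}_0$ be a coherent lower prevision on $\mathcal{L}(\mathcal{X})$ with conjugate upper prevision $\overline{P}_0$. Let $\underline{P}(\cdot|X)$ be the vacuous conditional lower prevision on $\mathcal{L}(\mathcal{O})$ given by $\underline{P}(g|x)=\min_{o\in\Gamma(x)}g(o)$, let $\underline{P}$ be the joint lower prevision on $\mathcal{L}(\mathcal{X}\times\mathcal{O})$ obtained from $\underline{P}_0$ and $\underline{P}(\cdot|X)$, and let $\underline{R}(\cdot|O)$ be the regular extension of $\underline{P}$ to a conditional lower prevision on $\mathcal{L}(\mathcal{X})$ (all as defined in the context). For $o\in\mathcal{O}$ put $$\{o\}^*=\{x\in\mathcal{X}:o\in\Gamma(x)\},\qquad \{o\}_*=\{x\in\mathcal{X}:\Gamma(x)=\{o\}\}.$$ Let $o\in\mathcal{O}$ and let $f$ be any gamble on $\mathcal{X}$. If $\overline{P}_0(\{o\}^* )=0$, then $\underline{R}(f|o)=\min_{x\in\mathcal{X}}f(x)$. If $\overline{P}_0(\{o\}^* )>0$, then $\underline{R}(f|o)$ is the greatest value of $\mu\in\mathbb{R}$ such that $$\underline{P}_0\left(I_{\{o\}_*}\max\{f-\mu,0\}+I_{\{o\}^*}\min\{f-\mu,0\}\right)\geq 0 .$$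
   Context: Let $\mathcal{Z}$ be a finite non-empty set. A gamble on $\mathcal{Z}$ is a function $\mathcal{Z}\to\mathbb{R}$; $\mathcal{L}(\mathcal{Z})$ is the set of all gambles on $\mathcal{Z}$. For $A\subseteq\mathcal{Z}$, $I_A$ is its indicator function. A linear prevision on $\mathcal{L}(\mathcal{Z})$ is a map $P:\mathcal{L}(\mathcal{Z})\to\mathbb{R}$ with $\min f\le P(f)\le\max f$, $P(f+g)=P(f)+P(g)$ and $P(\lambda f)=\lambda P(f)$ for all gambles $f,g$ and real $\lambda$; equivalently $P(f)=\sum_{z}f(z)p(z)$ for a probability mass function $p$ on $\mathcal{Z}$. $\mathcal{P}(\mathcal{Z})$ is the set of linear previsions. For a map (lower prevision) $\underline{Q}:\mathcal{L}(\mathcal{Z})\to\mathbb{R}$ let $\mathcal{M}(\underline{Q})=\{P\in\mathcal{P}(\mathcal{Z}):\underline{Q}(f)\le P(f)\text{ for all }f\in\mathcal{L}(\mathcal{Z})\}$. $\underline{Q}$ is coherent if $\mathcal{M}(\underline{Q})\neq\emptyset$ and $\underline{Q}(f)=\inf\{P(f):P\in\mathcal{M}(\underline{Q})\}$ for all $f$. The conjugate upper prevision is $\overline{Q}(f)=-\underline{Q}(-f)$. For an event $A\subseteq\mathcal{Z}$ write $\underline{Q}(A)=\underline{Q}(I_A)$, $\overline{Q}(A)=\overline{Q}(I_A)$ and $P(A)=P(I_A)$. Joint model: the lower prevision $\underline{P}$ on $\mathcal{L}(\mathcal{X}\times\mathcal{O})$ obtained from $\underline{P}_0$ and $\underline{P}(\cdot|X)$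 is the smallest coherent lower prevision compatible with them, namely $$\underline{P}(h)=\underline{P}_0\big(\underline{P}(h|X)\big),\qquad \underline{P}(h|X)(x)=\underline{P}(h(x,\cdot)|x)=\min_{o\in\Gamma(x)}h(x,o),\qquad h\in\mathcal{L}(\mathcal{X}\times\mathcal{O}).$$ Regular extension: for $o\in\mathcal{O}$ and $f\in\mathcal{L}(\mathcal{X})$ (identified, where needed, with the gamble $(x,o')\mapsto f(x)$ on $\mathcal{X}\times\mathcal{O}$), $\underline{R}(f|o)$ is defined as follows. If $\overline{P}(\mathcal{X}\times\{o\})=0$, then $\underline{R}(f|o)=\min_{x\in\mathcal{X}}f(x)$. If $\overline{P}(\mathcal{X}\times\{o\})>0$, then $$\underline{R}(f|o)=\inf\left\{\frac{P(f\,I_{\mathcal{X}\times\{o\}})}{P(\mathcal{X}\times\{o\})}:P\in\mathcal{M}(\underline{P}),\ P(\mathcal{X}\times\{o\})>0\right\}.$$ *)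

theory Defs
  imports Complex_Main "HOL-Library.Indicator_Function"
begin

text \<open>
  The finite non-empty sets of outcomes are rendered as types of class \<open>finite\<close>
  (every type is inhabited), so the gambles on such a set are all the
  real-valued functions on the type.
\<close>

type_synonym 'z gamble = "'z \<Rightarrow> real"

definition linear_prevision :: "('z::finite gamble \<Rightarrow> real) \<Rightarrow> bool" where
  "linear_prevision P \<longleftrightarrow>
     (\<forall>f. Min (range f) \<le> P f \<and> P f \<le> Max (range f)) \<and>
     (\<forall>f g. P (\<lambda>z. f z + g z) = P f + P g) \<and>
     (\<forall>(c::real) f. P (\<lambda>z. c * f z) = c * P f)"

definition credal_set :: "('z::finite gamble \<Rightarrow> real) \<Rightarrow> ('z gamble \<Rightarrow> real) set" where
  "credal_set Q = {P. linear_prevision P \<and> (\<forall>f. Q f \<le> P f)}"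

text \<open>
  The infimum below is a genuine one: the values \<open>P f\<close> are bounded below by
  \<open>Min (range f)\<close>, and the index set is required to be non-empty.
\<close>

definition coherent_prevision :: "('z::finite gamble \<Rightarrow> real) \<Rightarrow> bool" where
  "coherent_prevision Q \<longleftrightarrow>
     credal_set Q \<noteq> {} \<and> (\<forall>f. Q f = (INF P\<in>credal_set Q. P f))"

definition conjugate :: "('z gamble \<Rightarrow> real) \<Rightarrow> 'z gamble \<Rightarrow> real" where
  "conjugate Q f = - Q (\<lambda>z. - f z)"

definition vacuous_conditional :: "('x \<Rightarrow> 'o set) \<Rightarrow> 'o::finite gamble \<Rightarrow> 'x \<Rightarrow> real" where
  "vacuous_conditional \<Gamma> g x = Min (g ` \<Gamma> x)"

definition joint_prevision ::
    "('x::finite gamble \<Rightarrow> real) \<Rightarrow> ('x \<Rightarrow> 'o::finite set) \<Rightarrow> ('x \<times> 'o) gamble \<Rightarrow> real" where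
  "joint_prevision P\<^sub>0 \<Gamma> h = P\<^sub>0 (\<lambda>x. vacuous_conditional \<Gamma> (\<lambda>y. h (x, y)) x)"

text \<open>
  For a coherent \<open>Q\<close> the conjugate upper probability of an event is
  non-negative, so the second branch is the case of positive upper probability
  of the conditioning event; the set there is then non-empty and bounded below.
\<close>

definition regular_extension ::
    "(('x::finite \<times> 'o::finite) gamble \<Rightarrow> real) \<Rightarrow> 'x gamble \<Rightarrow> 'o \<Rightarrow> real" where
  "regular_extension Q f \<omega> =
     (if conjugate Q (indicator (UNIV \<times> {\<omega>})) = 0 then Min (range f)
      else Inf {P (\<lambda>z. f (fst z) * indicator (UNIV \<times> {\<omega>}) z) / P (indicator (UNIV \<times> {\<omega>})) | P.
                  P \<in> credal_set Q \<and> P (indicator (UNIV \<times> {\<omega>})) > 0})"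

definition upper_inverse :: "('x \<Rightarrow> 'o set) \<Rightarrow> 'o \<Rightarrow> 'x set" where
  "upper_inverse \<Gamma> \<omega> = {x. \<omega> \<in> \<Gamma> x}"

definition lower_inverse :: "('x \<Rightarrow> 'o set) \<Rightarrow> 'o \<Rightarrow> 'x set" where
  "lower_inverse \<Gamma> \<omega> = {x. \<Gamma> x = {\<omega>}}"

end

theory Submission imports Defs begin

text \<open>
  The credal set of the joint model contains every linear prevision obtained from an element of
  the credal set of \<open>P\<^sub>0\<close> by letting the observation be a selection of \<open>\<Gamma>\<close>; choosing the
  selection that minimises a given gamble shows that these determine the joint lower prevision.
  The gamble \<open>G \<mu>\<close> is exactly \<open>min\<close> over \<open>\<Gamma> x\<close> of \<open>(f - \<mu>) * I\<close>, where \<open>I\<close> is the indicator of the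
  conditioning event, so \<open>P\<^sub>0 (G \<mu>) \<ge> 0\<close> says that \<open>P (f * I) \<ge> \<mu> * P I\<close> for every \<open>P\<close> in the joint
  credal set, that is, that \<open>\<mu>\<close> is a lower bound of the ratios defining the regular extension.
\<close>

lemma linear_prevision_nonneg:
  assumes "linear_prevision P" and "\<And>z. f z \<ge> 0"
  shows "P f \<ge> 0"
proof -
  have "0 \<le> Min (range f)" using assms(2) by simp
  also have "\<dots> \<le> P f" using assms(1) by (simp add: linear_prevision_def)
  finally show ?thesis .
qed

lemma linear_prevision_add:
  "linear_prevision P \<Longrightarrow> P (\<lambda>z. f z + g z) = P f + P g"
  by (simp add: linear_prevision_def)

lemma linear_prevision_cmult:
  "linear_prevision P \<Longrightarrow> P (\<lambda>z. c * f z) = c * P f"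
  by (simp add: linear_prevision_def)

lemma linear_prevision_diff:
  assumes "linear_prevision P"
  shows "P (\<lambda>z. f z - c * g z) = P f - c * P g"
  using linear_prevision_add[OF assms, of f "\<lambda>z. - c * g z"]
    linear_prevision_cmult[OF assms, of "- c" g] by simp

lemma linear_prevision_mono:
  assumes "linear_prevision P" and "\<And>z. f z \<le> g z"
  shows "P f \<le> P g"
  using linear_prevision_nonneg[OF assms(1), of "\<lambda>z. g z - 1 * f z"] assms(2)
    linear_prevision_diff[OF assms(1), of g 1 f] by simp

text \<open>Composition with \<open>s\<close> can only shrink the set of values of a gamble, so the
  bounds survive. It is applied to the graph of a selection, which turns a prevision on the states
  into one on pairs.\<close>

lemma linear_prevision_pushforward:
  fixes s :: "'x::finite \<Rightarrow> 'z::finite"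
  assumes "linear_prevision P"
  shows "linear_prevision (\<lambda>g. P (\<lambda>x. g (s x)))"
  unfolding linear_prevision_def
proof (intro conjI allI)
  fix g :: "'z gamble"
  have "range (\<lambda>x. g (s x)) \<subseteq> range g" by auto
  then have "Min (range g) \<le> Min (range (\<lambda>x. g (s x)))" "Max (range (\<lambda>x. g (s x))) \<le> Max (range g)"
    by (intro Min_antimono Max_mono; simp)+
  moreover have "Min (range (\<lambda>x. g (s x))) \<le> P (\<lambda>x. g (s x))"
    "P (\<lambda>x. g (s x)) \<le> Max (range (\<lambda>x. g (s x)))"
    using assms by (auto simp: linear_prevision_def)
  ultimately show "Min (range g) \<le> P (\<lambda>x. g (s x))" "P (\<lambda>x. g (s x)) \<le> Max (range g)"
    by linarith+
qed (use assms in \<open>simp_all add: linear_prevision_def\<close>)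

text \<open>The bound is strict because an infimum only yields elements arbitrarily close to
  it.\<close>

lemma coherent_less_witness:
  assumes "coherent_prevision Q" and "Q f < c"
  obtains P where "P \<in> credal_set Q" "P f < c"
proof -
  have "credal_set Q \<noteq> {}" "(INF P\<in>credal_set Q. P f) < c"
    using assms by (auto simp: coherent_prevision_def)
  then show ?thesis
    using that cInf_lessD[of "(\<lambda>P. P f) ` credal_set Q" c] by blast
qed

text \<open>Transfers the witness property from \<open>P\<^sub>0\<close> to the joint model: a
  witness \<open>p\<close> for the inner minimum of \<open>h\<close> is pushed along a selection
  that attains this minimum.\<close>

lemma joint_less_witness:
  fixes \<Gamma> :: "'x::finite \<Rightarrow> 'o::finite set"
  assumes ne: "\<And>x. \<Gamma> x \<noteq> {}" and coh: "coherent_prevision P\<^sub>0"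
    and less: "joint_prevision P\<^sub>0 \<Gamma> h < c"
  obtains P where "P \<in> credal_set (joint_prevision P\<^sub>0 \<Gamma>)" "P h < c"
proof -
  let ?v = "\<lambda>h x. vacuous_conditional \<Gamma> (\<lambda>y. h (x, y)) x"
  obtain p where p: "p \<in> credal_set P\<^sub>0" "p (?v h) < c"
    by (rule coherent_less_witness[OF coh less[unfolded joint_prevision_def]])
  have lin: "linear_prevision p" and dom: "\<And>g. P\<^sub>0 g \<le> p g"
    using p(1) by (auto simp: credal_set_def)
  have "\<forall>x. \<exists>y. y \<in> \<Gamma> x \<and> ?v h x = h (x, y)"
  proof
    fix x
    have "Min ((\<lambda>y. h (x, y)) ` \<Gamma> x) \<in> (\<lambda>y. h (x, y)) ` \<Gamma> x"
      using ne by (intro Min_in) simp_all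
    then show "\<exists>y. y \<in> \<Gamma> x \<and> ?v h x = h (x, y)"
      unfolding vacuous_conditional_def by (rule imageE) (rule exI, rule conjI)
  qed
  from choice[OF this] obtain s where "\<forall>x. s x \<in> \<Gamma> x \<and> ?v h x = h (x, s x)" ..
  then have s: "s x \<in> \<Gamma> x" "?v h x = h (x, s x)" for x by simp_all
  let ?P = "\<lambda>g. p (\<lambda>x. g (x, s x))"
  \<comment> \<open>The selection is tuned to \<open>h\<close>, yet domination holds for every
    \<open>g\<close>: any value at a point of \<open>\<Gamma> x\<close> is at least the minimum over
    \<open>\<Gamma> x\<close>.\<close>
  have "joint_prevision P\<^sub>0 \<Gamma> g \<le> ?P g" for g
  proof -
    have "?v g x \<le> g (x, s x)" for x
      using s(1) by (simp add: vacuous_conditional_def)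
    then have "p (?v g) \<le> ?P g" by (rule linear_prevision_mono[OF lin])
    then show ?thesis using dom[of "?v g"] by (simp add: joint_prevision_def)
  qed
  then have "?P \<in> credal_set (joint_prevision P\<^sub>0 \<Gamma>)"
    using linear_prevision_pushforward[OF lin, of "\<lambda>x. (x, s x)"] by (simp add: credal_set_def)
  moreover have "?P h < c" using p(2) s(2) by simp
  ultimately show ?thesis by (rule that)
qed

text \<open>The gamble takes the value \<open>c\<close> at \<open>\<omega>\<close> and 0 elsewhere,
  so the minimum over \<open>\<Gamma> x\<close> is \<open>c\<close>, 0 or \<open>min c 0\<close>,
  according to whether \<open>\<Gamma> x\<close> is \<open>{\<omega>}\<close>, misses
  \<open>\<omega>\<close>, or contains \<open>\<omega>\<close> and another point. In the first case
  both indicators are 1 and the positive and negative parts add up to \<open>c\<close>.\<close>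

lemma vacuous_conditional_single:
  assumes "\<Gamma> x \<noteq> {}"
  shows "vacuous_conditional \<Gamma> (\<lambda>y. c * indicator {\<omega>} y) x =
    indicator (lower_inverse \<Gamma> \<omega>) x * max c 0 + indicator (upper_inverse \<Gamma> \<omega>) x * min c 0"
proof -
  consider "\<Gamma> x = {\<omega>}" | "\<omega> \<notin> \<Gamma> x" | "\<omega> \<in> \<Gamma> x" "\<Gamma> x \<noteq> {\<omega>}" by blast
  then show ?thesis
  proof cases
    case 1
    then show ?thesis
      by (simp add: vacuous_conditional_def lower_inverse_def upper_inverse_def)
  next
    case 2
    then have "(\<lambda>y. c * indicator {\<omega>} y) ` \<Gamma> x = {0}"
      using assms by (auto simp: indicator_def image_iff)
    moreover have "\<Gamma> x \<noteq> {\<omega>}" using 2 by blast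
    ultimately show ?thesis
      using 2 by (simp add: vacuous_conditional_def lower_inverse_def upper_inverse_def)
  next
    case 3
    then obtain y where "y \<in> \<Gamma> x" "y \<noteq> \<omega>" by blast
    with 3 have "(\<lambda>y. c * indicator {\<omega>} y) ` \<Gamma> x = {c, 0}"
      by (auto simp: indicator_def image_iff)
    then show ?thesis
      using 3 by (simp add: vacuous_conditional_def lower_inverse_def upper_inverse_def)
  qed
qed

lemma joint_prevision_single:
  fixes P\<^sub>0 :: "'x::finite gamble \<Rightarrow> real" and \<Gamma> :: "'x \<Rightarrow> 'o::finite set"
  assumes "\<And>x. \<Gamma> x \<noteq> {}"
  shows "joint_prevision P\<^sub>0 \<Gamma> (\<lambda>z. k (fst z) * indicator (UNIV \<times> {\<omega>}) z) =
    P\<^sub>0 (\<lambda>x. indicator (lower_inverse \<Gamma> \<omega>) x * max (k x) 0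
            + indicator (upper_inverse \<Gamma> \<omega>) x * min (k x) 0)"
proof -
  have "indicator (UNIV \<times> {\<omega>}) (x, y) = (indicator {\<omega>} y :: real)" for x :: 'x and y
    by (simp add: indicator_def)
  then show ?thesis
    using assms by (simp add: joint_prevision_def vacuous_conditional_single)
qed

text \<open>For the constant -1 the positive part vanishes and the negative part leaves minus the
  indicator of the upper inverse.\<close>

lemma conjugate_joint_single:
  assumes "\<And>x. \<Gamma> x \<noteq> {}"
  shows "conjugate (joint_prevision P\<^sub>0 \<Gamma>) (indicator (UNIV \<times> {\<omega>}))
       = conjugate P\<^sub>0 (indicator (upper_inverse \<Gamma> \<omega>))"
  using joint_prevision_single[OF assms, where k = "\<lambda>_. - 1"] by (simp add: conjugate_def)

text \<open>Lower bounds of the ratios correspond to non-negative values of \<open>Q\<close>: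
  domination by the credal set gives one direction, \<open>less_witness\<close> the other. The
  infimum is the greatest such bound.\<close>

lemma regular_extension_greatest:
  fixes Q :: "('x::finite \<times> 'o::finite) gamble \<Rightarrow> real" and f :: "'x gamble" and \<omega> :: 'o
  defines "I \<equiv> indicator (UNIV \<times> {\<omega>}) :: ('x \<times> 'o) gamble"
  assumes less_witness: "\<And>h c. Q h < c \<Longrightarrow> \<exists>P\<in>credal_set Q. P h < c"
    and pos: "conjugate Q I > 0"
  shows "0 \<le> Q (\<lambda>z. (f (fst z) - regular_extension Q f \<omega>) * I z)"
    and "0 \<le> Q (\<lambda>z. (f (fst z) - \<mu>) * I z) \<Longrightarrow> \<mu> \<le> regular_extension Q f \<omega>"
proof -
  define S where
    "S = (\<lambda>P. P (\<lambda>z. f (fst z) * I z) / P I) ` {P. P \<in> credal_set Q \<and> P I > 0}"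
  have S: "S = {P (\<lambda>z. f (fst z) * I z) / P I | P. P \<in> credal_set Q \<and> P I > 0}"
    unfolding S_def by (rule setcompr_eq_image[symmetric])
  have in_S: "P (\<lambda>z. f (fst z) * I z) / P I \<in> S" if "P \<in> credal_set Q" "P I > 0" for P
    unfolding S_def using that by (intro imageI) simp
  have "conjugate Q I \<noteq> 0" using pos by simp
  then have R: "regular_extension Q f \<omega> = Inf S"
    unfolding regular_extension_def S I_def[symmetric] by (rule if_not_P)
  have lin: "linear_prevision P" and dom: "Q h \<le> P h" if "P \<in> credal_set Q" for P h
    using that by (auto simp: credal_set_def)
  have I: "I z \<ge> 0" for z by (simp add: I_def)
  have shift: "P (\<lambda>z. (f (fst z) - m) * I z) = P (\<lambda>z. f (fst z) * I z) - m * P I"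
    if "P \<in> credal_set Q" for P m
    using linear_prevision_diff[OF lin[OF that], of "\<lambda>z. f (fst z) * I z" m I]
    by (simp add: left_diff_distrib)
  have ratio: "m \<le> P (\<lambda>z. f (fst z) * I z) / P I \<longleftrightarrow> 0 \<le> P (\<lambda>z. (f (fst z) - m) * I z)"
    if "P \<in> credal_set Q" "P I > 0" for P m
    using shift[OF that(1), of m] that(2) by (simp add: le_divide_eq)
  \<comment> \<open>Positive upper probability produces a \<open>P\<close> giving the conditioning
    event positive probability, so the infimum ranges over a non-empty set.\<close>
  have "Q (\<lambda>z. - I z) < 0" using pos by (simp add: conjugate_def)
  from less_witness[OF this] obtain P where P: "P \<in> credal_set Q" "P (\<lambda>z. - I z) < 0" ..
  then have "P I > 0" using linear_prevision_cmult[OF lin[OF P(1)], of "- 1" I] by simp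
  from in_S[OF P(1) this] have "S \<noteq> {}" by auto
  have "Min (range f) \<le> r" if "r \<in> S" for r
  proof -
    obtain P where P: "P \<in> credal_set Q" "P I > 0" "r = P (\<lambda>z. f (fst z) * I z) / P I"
      using \<open>r \<in> S\<close> unfolding S_def by (elim imageE CollectE conjE)
    have "0 \<le> P (\<lambda>z. (f (fst z) - Min (range f)) * I z)"
      using I by (intro linear_prevision_nonneg[OF lin[OF P(1)]]) simp
    then show ?thesis unfolding P(3) ratio[OF P(1,2)] .
  qed
  then have bdd: "bdd_below S" by (rule bdd_belowI)
  show "\<mu> \<le> regular_extension Q f \<omega>" if "0 \<le> Q (\<lambda>z. (f (fst z) - \<mu>) * I z)"
    unfolding R
  proof (rule cInf_greatest[OF \<open>S \<noteq> {}\<close>])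
    fix r assume "r \<in> S"
    then obtain P where P: "P \<in> credal_set Q" "P I > 0" "r = P (\<lambda>z. f (fst z) * I z) / P I"
      unfolding S_def by (elim imageE CollectE conjE)
    have "0 \<le> P (\<lambda>z. (f (fst z) - \<mu>) * I z)"
      using that dom[OF P(1)] by (rule order_trans)
    then show "\<mu> \<le> r" unfolding P(3) ratio[OF P(1,2)] .
  qed
  show "0 \<le> Q (\<lambda>z. (f (fst z) - regular_extension Q f \<omega>) * I z)"
  \<comment> \<open>A negative value of \<open>Q\<close> would be witnessed by some \<open>P\<close>
    in the credal set. If \<open>P I > 0\<close>, its ratio would lie below
    \<open>Inf S\<close>.\<close>
  proof (rule ccontr)
    assume "\<not> ?thesis"
    then have "Q (\<lambda>z. (f (fst z) - Inf S) * I z) < 0" by (simp add: R)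
    from less_witness[OF this]
    obtain P where P: "P \<in> credal_set Q" "P (\<lambda>z. (f (fst z) - Inf S) * I z) < 0" ..
    have "0 \<le> P I" by (rule linear_prevision_nonneg[OF lin[OF P(1)] I])
    then consider "P I > 0" | "P I = 0" by linarith
    then show False
    proof cases
      case 1
      have "Inf S \<le> P (\<lambda>z. f (fst z) * I z) / P I"
        by (rule cInf_lower[OF in_S[OF P(1) 1] bdd])
      then show False unfolding ratio[OF P(1) 1] using P(2) by linarith
    next
      case 2
      \<comment> \<open>With \<open>P I = 0\<close> there is no ratio to compare, but this bound
        makes \<open>P\<close> non-negative on \<open>f * I\<close>, and the shift by
        \<open>Inf S\<close> contributes 0.\<close>
      have "Min (range f) * P I \<le> P (\<lambda>z. f (fst z) * I z)"
        unfolding linear_prevision_cmult[OF lin[OF P(1)], symmetric]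
        using I by (intro linear_prevision_mono[OF lin[OF P(1)]] mult_right_mono) simp_all
      with 2 shift[OF P(1), of "Inf S"] P(2) show False by simp
    qed
  qed
qed

theorem theorem1:
  fixes P\<^sub>0 :: "'x::finite gamble \<Rightarrow> real"
    and \<Gamma> :: "'x \<Rightarrow> 'o::finite set"
    and \<omega> :: 'o
    and f :: "'x gamble"
  assumes "\<And>x. \<Gamma> x \<noteq> {}"
    and "coherent_prevision P\<^sub>0"
  defines "R \<equiv> regular_extension (joint_prevision P\<^sub>0 \<Gamma>) f \<omega>"
    and "G \<equiv> (\<lambda>\<mu> x. indicator (lower_inverse \<Gamma> \<omega>) x * max (f x - \<mu>) 0
                     + indicator (upper_inverse \<Gamma> \<omega>) x * min (f x - \<mu>) 0)"
  shows "(conjugate P\<^sub>0 (indicator (upper_inverse \<Gamma> \<omega>)) = 0 \<longrightarrow> R = Min (range f)) \<and>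
         (conjugate P\<^sub>0 (indicator (upper_inverse \<Gamma> \<omega>)) > 0 \<longrightarrow>
            P\<^sub>0 (G R) \<ge> 0 \<and> (\<forall>\<mu>::real. P\<^sub>0 (G \<mu>) \<ge> 0 \<longrightarrow> \<mu> \<le> R))"
proof -
  let ?Q = "joint_prevision P\<^sub>0 \<Gamma>"
  have conj: "conjugate ?Q (indicator (UNIV \<times> {\<omega>})) = conjugate P\<^sub>0 (indicator (upper_inverse \<Gamma> \<omega>))"
    by (rule conjugate_joint_single[OF assms(1)])
  have G: "?Q (\<lambda>z. (f (fst z) - \<mu>) * indicator (UNIV \<times> {\<omega>}) z) = P\<^sub>0 (G \<mu>)" for \<mu>
    unfolding G_def by (rule joint_prevision_single[OF assms(1)])
  have witness: "\<exists>P\<in>credal_set ?Q. P h < c" if "?Q h < c" for h c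
    using joint_less_witness[OF assms(1,2) that] by blast
  show ?thesis
  proof (intro conjI impI allI)
    assume "conjugate P\<^sub>0 (indicator (upper_inverse \<Gamma> \<omega>)) = 0"
    then show "R = Min (range f)" by (simp add: R_def regular_extension_def conj)
  next
    assume "conjugate P\<^sub>0 (indicator (upper_inverse \<Gamma> \<omega>)) > 0"
    then have pos: "conjugate ?Q (indicator (UNIV \<times> {\<omega>})) > 0" by (simp add: conj)
    show "P\<^sub>0 (G R) \<ge> 0"
      using regular_extension_greatest(1)[OF witness pos, where f = f] by (simp add: G R_def)
    show "\<mu> \<le> R" if "P\<^sub>0 (G \<mu>) \<ge> 0" for \<mu>
      using regular_extension_greatest(2)[OF witness pos, where f = f] that by (simp add: G R_def)
  qed
qed

end
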